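(* Let $X$ be a topological space, $\mathcal F$ a family of subsets of $X$, and let $\lambda$ and $\mu$ be infinite cardinals. The following are equivalent. (1) $X$ is $\mathcal F$-$[\mu,\lambda]$-compact. (2) For every sequence $(P_\alpha)_{\alpha\in\lambda}$ of subsets of $X$, if for every $Z\subseteq\lambda$ with $|Z|<\mu$ there exists some $F_Z\in\mathcal F$ such that $\bigcap_{\alpha\in Z}P_\alpha\supseteq F_Z$, then $\bigcap_{\alpha\in\lambda}\overline{P_\alpha}\neq\emptyset$. (3) For every sequence $(Q_\alpha)_{\alpha\in\lambda}$ of sets in $\bigvee\mathcal F$ (equivalently, in $\bigvee_{\leq\kappa}\mathcal F$, where $\kappa=\lambda^{<\mu}$; the value of $\kappa$ can be improved to $\operatorname{cf}S_\mu(\lambda)$), if for every $Z\subseteq\lambda$ with $|Z|<\mu$ there exists some $F_Z\in\mathcal F$ such that $\bigcap_{\alpha\in Z}Q_\alpha\supseteq F_Z$, then $\bigcap_{\alpha\in\lambda}\overline{Q_\alpha}\neq\emptyset$. (4) For every sequence $\{F_Z\mid Z\in S_\mu(\lambda)\}$ of members of $\mathcal F$, we have $\bigcap_{\alpha\in\lambda}\overline{\bigcup\{F_Z\mid Z\in S_\mu(\lambda),\ \alpha\in Z\}}\neq\emptyset$. (5) For every sequence $\{F_Z\mid Z\in S_\mu(\lambda)\}$ of members of $\mathcal F$, the following holds: if for every finite subset $W$ of $\lambda$ we put $Q_W=\bigcup\{F_Z\mid Z\in S_\mu(\lambda)\text{ and }Z\supseteq W\}$, then $\bigcap\{\overline{Q_W}\mid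 W\text{ is a finite subset of }\lambda\}\neq\emptyset$. (6) For every $\lambda$-indexed open cover $(Q_\alpha)_{\alpha\in\lambda}$ of $X$, there exists $Z\subseteq\lambda$ with $|Z|<\mu$ such that $F\cap\bigcup_{\alpha\in Z}Q_\alpha\neq\emptyset$ for every $F\in\mathcal F$. (7) For every sequence $\{F_Z\mid Z\in S_\mu(\lambda)\}$ of elements of $\mathcal F$, there exists an ultrafilter $D$ over $S_\mu(\lambda)$ which covers $\lambda$ and such that $\{F_Z\mid Z\in S_\mu(\lambda)\}$ has some $D$-limit point in $X$.
   Context: No separation axiom is assumed. $S_\mu(\lambda)$ denotes the set of all subsets of $\lambda$ of cardinality $<\mu$; $\lambda^{<\mu}=\sup_{\mu'<\mu}\lambda^{\mu'}$. $\operatorname{cf}S_\mu(\lambda)$ is the minimal cardinality of a subset $H\subseteq S_\mu(\lambda)$ that is cofinal, i.e. for every $Z\in S_\mu(\lambda)$ there is $Z'\in H$ with $Z\subseteq Z'$. "Sequence" means an indexed family (repetitions allowed). Intersections over an empty index set of subsets of $X$ equal $X$. $X$ is $\mathcal F$-$[\mu,\lambda]$-compact if for every sequence $(C_\alpha)_{\alpha\in\lambda}$ of closed sets of $X$: if for every $Z\subseteq\lambda$ with $|Z|<\mu$ there exists $F\in\mathcal F$ such that $\bigcap_{\alpha\in Z}C_\alpha\supseteq F$, then $\bigcap_{\alpha\in\lambda}C_\alpha\neq\emptyset$. $\bigvee\mathcal F$ (respectively $\bigvee_{\leq\kappa}\mathcal F$) is the family of all subsets of $X$ which can be obtained as the union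 of the members of some subfamily of $\mathcal F$ (respectively, some subfamily of cardinality $\leq\kappa$). If $D$ is an ultrafilter over a set $I$ and $(Y_i)_{i\in I}$ is a sequence of subsets of $X$, a point $x\in X$ is a $D$-limit point of $(Y_i)_{i\in I}$ if $\{i\in I\mid Y_i\cap U\neq\emptyset\}\in D$ for every neighborhood $U$ of $x$. An ultrafilter $D$ over $S_\mu(\lambda)$ covers $\lambda$ if $\{Z\in S_\mu(\lambda)\mid\alpha\in Z\}\in D$ for every $\alpha\in\lambda$. *)

theory Defs
  imports "HOL-Analysis.Analysis"
begin

unbundle cardinal_syntax

text \<open>Cardinals are card orders \<open>r\<close>, with \<open>Cinfinite r\<close> for infinite ones; the elements of the
  cardinal \<open>r\<close>, used as indices, are those of \<open>Field r\<close>.\<close>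

definition small_subsets :: "'m rel \<Rightarrow> 'l rel \<Rightarrow> 'l set set" where
  "small_subsets \<mu> lam = {Z. Z \<subseteq> Field lam \<and> |Z| <o \<mu>}"

text \<open>The least member of a nonempty set of cardinals, determined up to \<open>=o\<close>.\<close>

definition min_card :: "'k rel set \<Rightarrow> 'k rel" where
  "min_card R = (SOME r. r \<in> R \<and> (\<forall>r'\<in>R. r \<le>o r'))"

lemma min_card:
  assumes "r0 \<in> R" and "\<And>r. r \<in> R \<Longrightarrow> Card_order r"
  shows "min_card R \<in> R" and "\<And>r. r \<in> R \<Longrightarrow> min_card R \<le>o r"
proof -
  have "\<exists>r. r \<in> R \<and> (\<forall>r'\<in>R. r \<le>o r')"
    using exists_minim_Card_order[of R] assms by blast
  then have "min_card R \<in> R \<and> (\<forall>r'\<in>R. min_card R \<le>o r')"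
    unfolding min_card_def by (rule someI_ex)
  then show "min_card R \<in> R" and "\<And>r. r \<in> R \<Longrightarrow> min_card R \<le>o r" by auto
qed

text \<open>The supremum of \<open>lam ^c \<mu>'\<close> over all cardinals \<open>\<mu>' <o \<mu>\<close>, as the least upper bound. Up to
  \<open>=o\<close>, the cardinals below \<open>\<mu>\<close> are the \<open>|M|\<close> with \<open>M \<subseteq> Field \<mu>\<close> and \<open>|M| <o \<mu>\<close>. The type
  \<open>'m \<Rightarrow> 'l\<close> is large enough to carry an upper bound.\<close>

definition weak_power_bounds :: "'l rel \<Rightarrow> 'm rel \<Rightarrow> ('m \<Rightarrow> 'l) rel set" where
  "weak_power_bounds lam \<mu> =
     {r. Card_order r \<and> (\<forall>M \<subseteq> Field \<mu>. |M| <o \<mu> \<longrightarrow> lam ^c |M| \<le>o r)}"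

definition weak_power :: "'l rel \<Rightarrow> 'm rel \<Rightarrow> ('m \<Rightarrow> 'l) rel" where
  "weak_power lam \<mu> = min_card (weak_power_bounds lam \<mu>)"

lemma weak_power_bounds_nonempty:
  "|UNIV :: ('m \<Rightarrow> 'l) set| \<in> weak_power_bounds (lam :: 'l rel) (\<mu> :: 'm rel)"
  by (auto simp: weak_power_bounds_def BNF_Cardinal_Arithmetic.cexp_def card_of_Card_order
      intro: card_of_mono1)

definition cofinal_families :: "'m rel \<Rightarrow> 'l rel \<Rightarrow> 'l set set set" where
  "cofinal_families \<mu> lam =
     {H. H \<subseteq> small_subsets \<mu> lam \<and> (\<forall>Z \<in> small_subsets \<mu> lam. \<exists>Z'\<in>H. Z \<subseteq> Z')}"

definition cf_small_subsets :: "'m rel \<Rightarrow> 'l rel \<Rightarrow> 'l set rel" where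
  "cf_small_subsets \<mu> lam = min_card (card_of ` cofinal_families \<mu> lam)"

lemma cofinal_families_nonempty: "small_subsets \<mu> lam \<in> cofinal_families \<mu> lam"
  by (auto simp: cofinal_families_def)

definition unions :: "'a set set \<Rightarrow> 'a set set" where
  "unions \<F> = {\<Union>\<G> |\<G>. \<G> \<subseteq> \<F>}"

definition unions_le :: "'k rel \<Rightarrow> 'a set set \<Rightarrow> 'a set set" where
  "unions_le \<kappa> \<F> = {\<Union>\<G> |\<G>. \<G> \<subseteq> \<F> \<and> |\<G>| \<le>o \<kappa>}"

text \<open>Intersecting with \<open>topspace X\<close> makes the empty intersection the whole space.\<close>

definition family_compact :: "'a topology \<Rightarrow> 'a set set \<Rightarrow> 'm rel \<Rightarrow> 'l rel \<Rightarrow> bool" where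
  "family_compact X \<F> \<mu> lam \<longleftrightarrow>
     (\<forall>C. (\<forall>\<alpha>\<in>Field lam. closedin X (C \<alpha>)) \<longrightarrow>
          (\<forall>Z \<in> small_subsets \<mu> lam. \<exists>F\<in>\<F>. F \<subseteq> topspace X \<inter> (\<Inter>\<alpha>\<in>Z. C \<alpha>)) \<longrightarrow>
          topspace X \<inter> (\<Inter>\<alpha>\<in>Field lam. C \<alpha>) \<noteq> {})"

definition ultrafilter_over :: "'i set \<Rightarrow> 'i set set \<Rightarrow> bool" where
  "ultrafilter_over I D \<longleftrightarrow>
     D \<subseteq> Pow I \<and> I \<in> D \<and> {} \<notin> D \<and>
     (\<forall>A\<in>D. \<forall>B\<in>D. A \<inter> B \<in> D) \<and>
     (\<forall>A\<in>D. \<forall>B. A \<subseteq> B \<and> B \<subseteq> I \<longrightarrow> B \<in> D) \<and>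
     (\<forall>A. A \<subseteq> I \<longrightarrow> A \<in> D \<or> I - A \<in> D)"

definition covers :: "'l set set set \<Rightarrow> 'm rel \<Rightarrow> 'l rel \<Rightarrow> bool" where
  "covers D \<mu> lam \<longleftrightarrow> (\<forall>\<alpha>\<in>Field lam. {Z \<in> small_subsets \<mu> lam. \<alpha> \<in> Z} \<in> D)"

definition neighborhood :: "'a topology \<Rightarrow> 'a \<Rightarrow> 'a set \<Rightarrow> bool" where
  "neighborhood X x U \<longleftrightarrow> U \<subseteq> topspace X \<and> (\<exists>V. openin X V \<and> x \<in> V \<and> V \<subseteq> U)"

definition limit_point :: "'a topology \<Rightarrow> 'i set \<Rightarrow> 'i set set \<Rightarrow> ('i \<Rightarrow> 'a set) \<Rightarrow> 'a \<Rightarrow> bool" where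
  "limit_point X I D Y x \<longleftrightarrow>
     x \<in> topspace X \<and> (\<forall>U. neighborhood X x U \<longrightarrow> {i \<in> I. Y i \<inter> U \<noteq> {}} \<in> D)"

end

theory Submission
  imports Defs "HOL-Algebra.Free_Abelian_Groups"
begin

text \<open>Everything turns on one exchange. A family \<open>(C \<alpha>)\<close> of sets whose small intersections each
  contain a member of \<open>\<F>\<close> yields, by choice, a function \<open>Fs\<close> from small index sets to \<open>\<F>\<close> with
  \<open>Fs Z \<subseteq> C \<alpha>\<close> whenever \<open>\<alpha> \<in> Z\<close>. Conversely, every choice function \<open>Fs\<close> yields the family
  \<open>Q \<alpha> = \<Union>{Fs Z | \<alpha> \<in> Z}\<close>, whose small intersections contain members of \<open>\<F>\<close>, namely
  \<open>Fs Z \<subseteq> (\<Inter>\<alpha>\<in>Z. Q \<alpha>)\<close>. In the first direction the closures of these \<open>Q \<alpha>\<close> lie in the closed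
  sets \<open>C \<alpha>\<close>, so a common point of the former is one of the latter
  (\<open>selection_imp_family_compact\<close>). In the second direction it is enough to let \<open>Z\<close> range over a
  cofinal family \<open>H\<close> of small sets, which makes \<open>Q \<alpha>\<close> a union of at most \<open>|H|\<close> members of \<open>\<F>\<close>
  (\<open>closure_compact_unions_le_imp_selection\<close>). So a compactness property that is tested only on
  such unions already gives the full one. Taking \<open>H\<close> of least size gives the bound by the
  cofinality, and taking all small sets gives the bound by the weak power, because there are at
  most \<open>weak_power lam \<mu>\<close> of them (\<open>card_small_subsets_le_weak_power\<close>).

  An infinite \<open>lam\<close> has only \<open>lam\<close> finite subsets, and a union of fewer than \<open>\<mu>\<close> finite sets is
  small. Hence the finite subsets \<open>W\<close> can serve as indices in place of the elements
  (\<open>family_imp_finite_selection_compact\<close>). The gain is that the sets of those \<open>Z\<close> for which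
  \<open>W \<subseteq> Z\<close> and \<open>Fs Z\<close> meets \<open>V\<close>, with \<open>V\<close> an open neighborhood of a point \<open>x\<close>, now form a filter base
  exactly when \<open>x\<close> is in all the closures. Any ultrafilter containing this base covers \<open>lam\<close> and
  has \<open>x\<close> as a limit point (\<open>finite_selection_imp_ultrafilter_compact\<close>). A limit point along a
  covering ultrafilter is in turn in the closure of each \<open>Q \<alpha>\<close>
  (\<open>ultrafilter_imp_selection_compact\<close>), which closes the circle. The formulation by open covers
  is the contrapositive of the one by closed sets, through complements.\<close>

section \<open>Small sets of indices\<close>

lemma finite_ordLess_Cinfinite:
  assumes "finite A" and "Cinfinite \<mu>"
  shows "|A| <o \<mu>"
  using assms
  by (intro finite_ordLess_infinite)
    (simp_all add: cinfinite_def Field_card_of card_of_Well_order card_order_on_well_order_on)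

text \<open>Singularity of \<open>\<mu>\<close> does no harm here because the sets are finite: for infinite \<open>Z\<close> their union
  has at most \<open>|Z|\<close> elements.\<close>

lemma small_subsets_UN:
  assumes "Cinfinite \<mu>" and "Z \<subseteq> Field lam" "|Z| <o \<mu>"
    and "\<And>\<beta>. \<beta> \<in> Z \<Longrightarrow> finite (g \<beta>)" and "\<And>\<beta>. \<beta> \<in> Z \<Longrightarrow> g \<beta> \<subseteq> Field lam"
  shows "(\<Union>\<beta>\<in>Z. g \<beta>) \<in> small_subsets \<mu> lam"
proof -
  have "|\<Union>\<beta>\<in>Z. g \<beta>| <o \<mu>"
  proof (cases "finite Z")
    case True
    then have "finite (\<Union>\<beta>\<in>Z. g \<beta>)" using assms(4) by simp
    then show ?thesis
      using assms(1) by (rule finite_ordLess_Cinfinite)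
  next
    case False
    then have "|\<Union>\<beta>\<in>Z. g \<beta>| \<le>o |Z|"
      using assms(4) by (intro card_of_UNION_ordLeq_infinite)
        (auto intro: ordLess_imp_ordLeq finite_ordLess_infinite2)
    then show ?thesis using assms(3) by (rule ordLeq_ordLess_trans)
  qed
  then show ?thesis using assms(5) by (auto simp: small_subsets_def)
qed

lemma weak_power_in_bounds: "weak_power lam \<mu> \<in> weak_power_bounds lam \<mu>"
  unfolding weak_power_def
  by (rule min_card(1)[OF weak_power_bounds_nonempty]) (simp add: weak_power_bounds_def)

lemma Card_order_weak_power: "Card_order (weak_power lam \<mu>)"
  using weak_power_in_bounds[of lam \<mu>] by (simp add: weak_power_bounds_def)

lemma cexp_le_weak_power:
  assumes "M \<subseteq> Field \<mu>" "|M| <o \<mu>"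
  shows "lam ^c |M| \<le>o weak_power lam \<mu>"
  using assms weak_power_in_bounds[of lam \<mu>] by (simp add: weak_power_bounds_def)

lemma base_le_weak_power:
  assumes "Cinfinite \<mu>" and "Card_order lam"
  shows "lam \<le>o weak_power lam \<mu>"
proof -
  obtain a where a: "a \<in> Field \<mu>"
    using assms(1) by (metis cinfinite_def equals0I finite.emptyI)
  have "lam \<le>o lam ^c |{a}|"
    using assms(2) by (intro ordLeq_cexp1) (auto simp: card_of_ordIso_czero_iff_empty)
  moreover have "|{a}| <o \<mu>"
    using assms(1) by (intro finite_ordLess_Cinfinite) auto
  ultimately show ?thesis
    using cexp_le_weak_power[of "{a}" \<mu> lam] a ordLeq_transitive by blast
qed

text \<open>If \<open>\<kappa> = weak_power lam \<mu>\<close> were less than \<open>\<mu>\<close>, it would itself be one of the exponents over which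
  the supremum is taken, so that \<open>lam ^c \<kappa> \<le>o \<kappa>\<close>, against Cantor's theorem. This makes the bound on the number of
  small sets valid also when \<open>\<mu>\<close> exceeds \<open>lam\<close>.\<close>

lemma exponent_le_weak_power:
  assumes "Cinfinite \<mu>" and "Cinfinite lam"
  shows "\<mu> \<le>o weak_power lam \<mu>"
proof (rule ccontr)
  let ?\<kappa> = "weak_power lam \<mu>"
  note co = Card_order_weak_power[of lam \<mu>]
  assume "\<not> \<mu> \<le>o ?\<kappa>"
  then have "?\<kappa> <o \<mu>"
    using assms(1) co by (auto simp: not_ordLeq_iff_ordLess card_order_on_well_order_on)
  then obtain a where a: "a \<in> Field \<mu>" "?\<kappa> =o Restr \<mu> (underS \<mu> a)"
    using assms(1) co ordLess_iff_ordIso_Restr card_order_on_well_order_on by metis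
  \<comment> \<open>The segment \<open>?M\<close> is a copy of \<open>?\<kappa>\<close> inside \<open>\<mu>\<close>, as the definition of the weak power requires
    of exponents.\<close>
  let ?M = "underS \<mu> a"
  have M: "?M \<subseteq> Field \<mu>" "|?M| <o \<mu>"
    using assms(1) a by (auto intro: underS_Field card_of_underS)
  have "Field (Restr \<mu> ?M) = ?M"
    using assms(1) wo_rel.underS_ofilter Field_Restr_ofilter card_order_on_well_order_on
    by (metis wo_rel_def)
  then have kM: "?\<kappa> =o |?M|"
    using a(2) co card_of_Field_ordIso card_of_cong ordIso_symmetric ordIso_transitive by metis
  have "?\<kappa> =o |?M|" by (rule kM)
  also have "|?M| <o ctwo ^c |?M|" by (rule ordLess_ctwo_cexp) (rule card_of_Card_order)
  also have "ctwo ^c |?M| \<le>o lam ^c |?M|"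
    using assms(2) by (intro cexp_mono1 card_of_Card_order ctwo_ordLeq_Cinfinite)
  also have "lam ^c |?M| \<le>o ?\<kappa>" by (rule cexp_le_weak_power[OF M])
  finally show False using ordLess_irreflexive by blast
qed

text \<open>Each small set is the image of a proper initial segment of \<open>\<mu>\<close>. There are only \<open>|\<mu>|\<close> such
  segments, and each has at most \<open>weak_power lam \<mu>\<close> functions into \<open>lam\<close>.\<close>

lemma card_small_subsets_le_weak_power:
  fixes \<mu> :: "'m rel" and lam :: "'l rel"
  assumes \<mu>: "Cinfinite \<mu>" and lam: "Cinfinite lam"
  shows "|small_subsets \<mu> lam| \<le>o weak_power lam \<mu>"
proof -
  let ?\<kappa> = "weak_power lam \<mu>"
  note co = Card_order_weak_power[of lam \<mu>]
  have inf: "Cinfinite ?\<kappa>"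
    using cinfinite_mono[OF base_le_weak_power] assms co by blast
  have wo: "Well_order \<mu>" using \<mu> by (simp add: card_order_on_well_order_on)
  let ?F = "\<lambda>a. Func (underS \<mu> a) (Field lam)"
  have sub: "small_subsets \<mu> lam \<subseteq> (\<Union>a\<in>Field \<mu>. (\<lambda>f. f ` underS \<mu> a) ` ?F a)"
  proof
    fix Z assume "Z \<in> small_subsets \<mu> lam"
    then have Z: "Z \<subseteq> Field lam" "|Z| <o \<mu>" by (auto simp: small_subsets_def)
    then obtain a where a: "a \<in> Field \<mu>" "|Z| =o Restr \<mu> (underS \<mu> a)"
      using wo ordLess_iff_ordIso_Restr card_of_Well_order by metis
    let ?M = "underS \<mu> a"
    have "Field (Restr \<mu> ?M) = ?M"
      using wo wo_rel.underS_ofilter Field_Restr_ofilter by (metis wo_rel_def)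
    then have "|?M| =o |Z|"
      using a(2) card_of_cong Field_card_of ordIso_symmetric by metis
    then obtain f where f: "bij_betw f ?M Z" using card_of_ordIso by blast
    \<comment> \<open>\<open>Func\<close> consists of functions that are \<open>undefined\<close> off their domain.\<close>
    define h where "h = (\<lambda>x. if x \<in> ?M then f x else undefined)"
    have "h ` ?M = Z" using f by (auto simp: h_def bij_betw_def)
    moreover have "h \<in> ?F a" using f Z by (auto simp: h_def Func_def bij_betw_def)
    ultimately show "Z \<in> (\<Union>a\<in>Field \<mu>. (\<lambda>f. f ` underS \<mu> a) ` ?F a)" using a(1) by blast
  qed
  have "|Field \<mu>| \<le>o ?\<kappa>"
    using exponent_le_weak_power[OF assms] \<mu> card_of_Field_ordIso ordIso_ordLeq_trans by blast
  moreover have "|(\<lambda>f. f ` underS \<mu> a) ` ?F a| \<le>o ?\<kappa>" if "a \<in> Field \<mu>" for a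
  proof -
    have "|?F a| \<le>o ?\<kappa>"
      using cexp_le_weak_power[of "underS \<mu> a" \<mu> lam] card_of_underS[of \<mu> a] \<mu> that
      by (auto simp: BNF_Cardinal_Arithmetic.cexp_def Field_card_of dest: underS_Field)
    then show ?thesis using card_of_image ordLeq_transitive by blast
  qed
  ultimately have "|\<Union>a\<in>Field \<mu>. (\<lambda>f. f ` underS \<mu> a) ` ?F a| \<le>o ?\<kappa>"
    using inf by (intro UNION_Cinfinite_bound) auto
  then show ?thesis using card_of_mono1[OF sub] ordLeq_transitive by blast
qed

lemma cofinal_family_attaining_cf:
  obtains H where "H \<in> cofinal_families \<mu> lam" and "|H| =o cf_small_subsets \<mu> lam"
proof -
  have "cf_small_subsets \<mu> lam \<in> card_of ` cofinal_families \<mu> lam"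
    unfolding cf_small_subsets_def
    by (rule min_card(1)[OF imageI[OF cofinal_families_nonempty]]) (auto simp: card_of_Card_order)
  then obtain H where "H \<in> cofinal_families \<mu> lam" "cf_small_subsets \<mu> lam = |H|" by blast
  then show thesis using that ordIso_refl[OF card_of_Card_order, of H] by simp
qed

lemma surj_finite_subsets:
  assumes "infinite A"
  obtains g where "g ` A = {W. finite W \<and> W \<subseteq> A}"
proof -
  have "Fpow A \<approx> A" using assms by (rule eqpoll_Fpow)
  then obtain g where "bij_betw g A (Fpow A)" using eqpoll_sym eqpoll_def by blast
  then show thesis using that by (auto simp: bij_betw_def Fpow_def conj_commute)
qed

section \<open>Ultrafilters extending a filter base\<close>

text \<open>The ultrafilter is a maximal family with the finite intersection property that contains the
  base. By maximality it contains every set that meets all its finite intersections, and the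
  filter axioms and the ultrafilter dichotomy are instances of this.\<close>

lemma ultrafilter_extending_base:
  assumes proper: "{} \<notin> B" and ne: "B \<noteq> {}" and sub: "B \<subseteq> Pow I"
    and dir: "\<And>A A'. A \<in> B \<Longrightarrow> A' \<in> B \<Longrightarrow> \<exists>A''\<in>B. A'' \<subseteq> A \<inter> A'"
  obtains D where "ultrafilter_over I D" "B \<subseteq> D"
proof -
  \<comment> \<open>Intersecting with \<open>I\<close> covers the empty subfamily, so that the property includes that \<open>I\<close> is
    nonempty.\<close>
  define fip where "fip = (\<lambda>M. \<forall>G. finite G \<longrightarrow> G \<subseteq> M \<longrightarrow> I \<inter> \<Inter>G \<noteq> {})"
  let ?\<A> = "{M. B \<subseteq> M \<and> M \<subseteq> Pow I \<and> fip M}"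
  have "\<exists>A\<in>B. A \<subseteq> I \<inter> \<Inter>G" if "finite G" "G \<subseteq> B" for G
    using that
  proof (induction G rule: finite_induct)
    case empty
    then show ?case using ne sub by auto
  next
    case (insert C G)
    then obtain A where A: "A \<in> B" "A \<subseteq> I \<inter> \<Inter>G" by auto
    moreover obtain A'' where "A'' \<in> B" "A'' \<subseteq> A \<inter> C"
      using dir[of A C] insert.prems A(1) by (meson insert_subset)
    ultimately show ?case by (intro bexI[of _ A'']) auto
  qed
  then have "fip B" using proper unfolding fip_def by (metis subset_empty)
  then have "?\<A> \<noteq> {}" using sub by blast
  moreover have "\<Union>\<C> \<in> ?\<A>" if c: "\<C> \<noteq> {}" "subset.chain ?\<A> \<C>" for \<C>
  proof -
    have "fip (\<Union>\<C>)"
      unfolding fip_def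
    proof (intro allI impI)
      fix G assume "finite G" "G \<subseteq> \<Union>\<C>"
      then obtain M where "M \<in> \<C>" "G \<subseteq> M"
        using finite_subset_Union_chain[of G \<C> ?\<A>] c by metis
      then show "I \<inter> \<Inter>G \<noteq> {}"
        using c(2) \<open>finite G\<close> unfolding subset.chain_def fip_def by blast
    qed
    have bounds: "B \<subseteq> M" "M \<subseteq> Pow I" if "M \<in> \<C>" for M
      using c(2) that unfolding subset.chain_def by auto
    obtain M where "M \<in> \<C>" using c(1) by blast
    then have "B \<subseteq> \<Union>\<C>" using bounds(1) by (meson Sup_upper2)
    moreover have "\<Union>\<C> \<subseteq> Pow I" using bounds(2) by (rule Sup_least)
    ultimately show ?thesis using \<open>fip (\<Union>\<C>)\<close> by simp
  qed
  ultimately obtain D where D: "D \<in> ?\<A>" and max: "\<And>M. M \<in> ?\<A> \<Longrightarrow> D \<subseteq> M \<Longrightarrow> M = D"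
    using subset_Zorn_nonempty[of ?\<A>] by auto
  have fipD: "I \<inter> \<Inter>G \<noteq> {}" if "finite G" "G \<subseteq> D" for G
    using D that by (auto simp: fip_def)
  have DI: "D \<subseteq> Pow I" and BD: "B \<subseteq> D" using D by auto
  have mem: "A \<in> D" if A: "A \<subseteq> I" and meets: "\<And>G. finite G \<Longrightarrow> G \<subseteq> D \<Longrightarrow> I \<inter> \<Inter>G \<inter> A \<noteq> {}" for A
  proof -
    have "fip (insert A D)"
      unfolding fip_def
    proof (intro allI impI)
      fix G assume "finite G" "G \<subseteq> insert A D"
      then have "I \<inter> \<Inter>(G - {A}) \<inter> A \<noteq> {}" by (intro meets) auto
      then show "I \<inter> \<Inter>G \<noteq> {}" by blast
    qed
    then have "insert A D = D" using A DI BD by (intro max) auto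
    then show ?thesis by blast
  qed
  have up: "A' \<in> D" if "A \<in> D" "A \<subseteq> A'" "A' \<subseteq> I" for A A'
  proof (rule mem)
    fix G assume "finite G" "G \<subseteq> D"
    then show "I \<inter> \<Inter>G \<inter> A' \<noteq> {}" using fipD[of "insert A G"] that by auto
  qed (use that in auto)
  have inter: "A \<inter> A' \<in> D" if "A \<in> D" "A' \<in> D" for A A'
  proof (rule mem)
    fix G assume "finite G" "G \<subseteq> D"
    then show "I \<inter> \<Inter>G \<inter> (A \<inter> A') \<noteq> {}" using fipD[of "insert A (insert A' G)"] that by auto
  qed (use that DI in auto)
  have ultra: "A \<in> D \<or> I - A \<in> D" if A: "A \<subseteq> I" for A
  proof (rule ccontr)
    assume "\<not> ?thesis"
    then obtain G H where "finite G" "G \<subseteq> D" "I \<inter> \<Inter>G \<inter> A = {}"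
      and "finite H" "H \<subseteq> D" "I \<inter> \<Inter>H \<inter> (I - A) = {}"
      using mem[of A] mem[of "I - A"] A by (metis Diff_subset)
    then have "I \<inter> \<Inter>(G \<union> H) = {}" "finite (G \<union> H)" "G \<union> H \<subseteq> D" by blast+
    then show False using fipD by blast
  qed
  have "I \<in> D" using ne BD sub up by blast
  moreover have "{} \<notin> D" using fipD[of "{{}}"] by auto
  ultimately have "ultrafilter_over I D"
    using DI inter up ultra unfolding ultrafilter_over_def by (intro conjI allI ballI impI) simp_all
  then show thesis using that BD by blast
qed

section \<open>Forms of compactness relative to a family\<close>

text \<open>The parameter \<open>\<Q>\<close> restricts the sets that are tested. The property weakens as \<open>\<Q>\<close> shrinks, so
  one proof from the smallest useful \<open>\<Q>\<close> and one to the largest settle all choices in between.\<close>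

definition closure_compact ::
  "'a set set \<Rightarrow> 'a topology \<Rightarrow> 'a set set \<Rightarrow> 'm rel \<Rightarrow> 'l rel \<Rightarrow> bool" where
  "closure_compact \<Q> X \<F> \<mu> lam \<longleftrightarrow>
     (\<forall>Q. (\<forall>\<alpha>\<in>Field lam. Q \<alpha> \<in> \<Q>) \<longrightarrow>
          (\<forall>Z \<in> small_subsets \<mu> lam. \<exists>F\<in>\<F>. F \<subseteq> topspace X \<inter> (\<Inter>\<alpha>\<in>Z. Q \<alpha>)) \<longrightarrow>
          topspace X \<inter> (\<Inter>\<alpha>\<in>Field lam. X closure_of Q \<alpha>) \<noteq> {})"

definition selection_compact :: "'a topology \<Rightarrow> 'a set set \<Rightarrow> 'm rel \<Rightarrow> 'l rel \<Rightarrow> bool" where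
  "selection_compact X \<F> \<mu> lam \<longleftrightarrow>
     (\<forall>Fs. (\<forall>Z \<in> small_subsets \<mu> lam. Fs Z \<in> \<F>) \<longrightarrow>
        topspace X \<inter> (\<Inter>\<alpha>\<in>Field lam.
          X closure_of (\<Union>{Fs Z |Z. Z \<in> small_subsets \<mu> lam \<and> \<alpha> \<in> Z})) \<noteq> {})"

definition finite_selection_compact ::
  "'a topology \<Rightarrow> 'a set set \<Rightarrow> 'm rel \<Rightarrow> 'l rel \<Rightarrow> bool" where
  "finite_selection_compact X \<F> \<mu> lam \<longleftrightarrow>
     (\<forall>Fs. (\<forall>Z \<in> small_subsets \<mu> lam. Fs Z \<in> \<F>) \<longrightarrow>
        topspace X \<inter> (\<Inter>W\<in>{W. finite W \<and> W \<subseteq> Field lam}.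
          X closure_of (\<Union>{Fs Z |Z. Z \<in> small_subsets \<mu> lam \<and> W \<subseteq> Z})) \<noteq> {})"

definition cover_compact :: "'a topology \<Rightarrow> 'a set set \<Rightarrow> 'm rel \<Rightarrow> 'l rel \<Rightarrow> bool" where
  "cover_compact X \<F> \<mu> lam \<longleftrightarrow>
     (\<forall>Q. (\<forall>\<alpha>\<in>Field lam. openin X (Q \<alpha>)) \<and> (\<Union>\<alpha>\<in>Field lam. Q \<alpha>) = topspace X \<longrightarrow>
        (\<exists>Z \<in> small_subsets \<mu> lam. \<forall>F\<in>\<F>. F \<inter> (\<Union>\<alpha>\<in>Z. Q \<alpha>) \<noteq> {}))"

definition ultrafilter_compact :: "'a topology \<Rightarrow> 'a set set \<Rightarrow> 'm rel \<Rightarrow> 'l rel \<Rightarrow> bool" where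
  "ultrafilter_compact X \<F> \<mu> lam \<longleftrightarrow>
     (\<forall>Fs. (\<forall>Z \<in> small_subsets \<mu> lam. Fs Z \<in> \<F>) \<longrightarrow>
        (\<exists>D. ultrafilter_over (small_subsets \<mu> lam) D \<and> covers D \<mu> lam \<and>
             (\<exists>x. limit_point X (small_subsets \<mu> lam) D Fs x)))"

section \<open>The equivalences\<close>

lemma family_imp_closure_compact:
  assumes fc: "family_compact X \<F> \<mu> lam"
  shows "closure_compact (Pow (topspace X)) X \<F> \<mu> lam"
  unfolding closure_compact_def
proof (intro allI impI)
  fix Q
  assume Q: "\<forall>\<alpha>\<in>Field lam. Q \<alpha> \<in> Pow (topspace X)"
    and small: "\<forall>Z\<in>small_subsets \<mu> lam. \<exists>F\<in>\<F>. F \<subseteq> topspace X \<inter> (\<Inter>\<alpha>\<in>Z. Q \<alpha>)"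
  have "\<exists>F\<in>\<F>. F \<subseteq> topspace X \<inter> (\<Inter>\<alpha>\<in>Z. X closure_of Q \<alpha>)" if Z: "Z \<in> small_subsets \<mu> lam" for Z
  proof -
    obtain F where "F \<in> \<F>" "F \<subseteq> topspace X \<inter> (\<Inter>\<alpha>\<in>Z. Q \<alpha>)" using small Z by blast
    moreover have "Q \<alpha> \<subseteq> X closure_of Q \<alpha>" if "\<alpha> \<in> Z" for \<alpha>
      using Q Z that by (intro closure_of_subset) (auto simp: small_subsets_def)
    ultimately show ?thesis by (intro bexI[of _ F]) fast+
  qed
  then show "topspace X \<inter> (\<Inter>\<alpha>\<in>Field lam. X closure_of Q \<alpha>) \<noteq> {}"
    using fc unfolding family_compact_def by simp
qed

lemma closure_compact_antimono:
  assumes "closure_compact \<Q> X \<F> \<mu> lam" and "\<Q>' \<subseteq> \<Q>"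
  shows "closure_compact \<Q>' X \<F> \<mu> lam"
  using assms unfolding closure_compact_def by (meson subsetD)

text \<open>It suffices to unite the \<open>Fs Z\<close> with \<open>Z\<close> in the cofinal family \<open>H\<close>: a small \<open>Z\<close> lies in some
  \<open>Z' \<in> H\<close>, and \<open>Fs Z'\<close> is below each \<open>Q \<alpha>\<close> with \<open>\<alpha> \<in> Z\<close>. The closures of these smaller unions are
  contained in the closures that must have a common point.\<close>

lemma closure_compact_unions_le_imp_selection:
  assumes cc: "closure_compact (unions_le \<kappa> \<F>) X \<F> \<mu> lam"
    and sub: "\<F> \<subseteq> Pow (topspace X)"
    and H: "H \<in> cofinal_families \<mu> lam" "|H| \<le>o \<kappa>"
  shows "selection_compact X \<F> \<mu> lam"
  unfolding selection_compact_def
proof (intro allI impI)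
  fix Fs
  assume Fs: "\<forall>Z\<in>small_subsets \<mu> lam. Fs Z \<in> \<F>"
  define Q where "Q \<alpha> = \<Union>(Fs ` {Z\<in>H. \<alpha> \<in> Z})" for \<alpha>
  have HS: "H \<subseteq> small_subsets \<mu> lam" using H(1) by (simp add: cofinal_families_def)
  have "Q \<alpha> \<in> unions_le \<kappa> \<F>" for \<alpha>
  proof -
    have "|Fs ` {Z\<in>H. \<alpha> \<in> Z}| \<le>o |{Z\<in>H. \<alpha> \<in> Z}|" by (rule card_of_image)
    also have "|{Z\<in>H. \<alpha> \<in> Z}| \<le>o |H|" by (rule card_of_mono1) auto
    also have "|H| \<le>o \<kappa>" by (rule H(2))
    finally have "|Fs ` {Z\<in>H. \<alpha> \<in> Z}| \<le>o \<kappa>" .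
    moreover have "Fs ` {Z\<in>H. \<alpha> \<in> Z} \<subseteq> \<F>" using Fs HS by blast
    ultimately show ?thesis unfolding unions_le_def Q_def by blast
  qed
  moreover have "\<exists>F\<in>\<F>. F \<subseteq> topspace X \<inter> (\<Inter>\<alpha>\<in>Z. Q \<alpha>)" if Z: "Z \<in> small_subsets \<mu> lam" for Z
  proof -
    obtain Z' where Z': "Z' \<in> H" "Z \<subseteq> Z'" using H(1) Z unfolding cofinal_families_def by blast
    then have "Fs Z' \<in> \<F>" using Fs HS by blast
    moreover have "Fs Z' \<subseteq> Q \<alpha>" if "\<alpha> \<in> Z" for \<alpha> using Z' that unfolding Q_def by blast
    ultimately show ?thesis using sub by (intro bexI[of _ "Fs Z'"]) auto
  qed
  ultimately have ne: "topspace X \<inter> (\<Inter>\<alpha>\<in>Field lam. X closure_of Q \<alpha>) \<noteq> {}"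
    using cc[unfolded closure_compact_def, rule_format, of Q] by simp
  have "X closure_of Q \<alpha> \<subseteq> X closure_of (\<Union>{Fs Z |Z. Z \<in> small_subsets \<mu> lam \<and> \<alpha> \<in> Z})" for \<alpha>
    by (rule closure_of_mono) (use HS in \<open>auto simp: Q_def\<close>)
  then show "topspace X \<inter> (\<Inter>\<alpha>\<in>Field lam.
      X closure_of (\<Union>{Fs Z |Z. Z \<in> small_subsets \<mu> lam \<and> \<alpha> \<in> Z})) \<noteq> {}"
    using ne by blast
qed

text \<open>For \<open>Fs Z\<close> take a member of \<open>\<F>\<close> inside the intersection of the \<open>C \<alpha>\<close> with \<open>\<alpha> \<in> Z\<close>. Then all
  \<open>Fs Z\<close> with \<open>\<alpha> \<in> Z\<close>, and so the closure of their union, are contained in the closed set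
  \<open>C \<alpha>\<close>.\<close>

lemma selection_imp_family_compact:
  assumes sc: "selection_compact X \<F> \<mu> lam"
  shows "family_compact X \<F> \<mu> lam"
  unfolding family_compact_def
proof (intro allI impI)
  fix C
  assume C: "\<forall>\<alpha>\<in>Field lam. closedin X (C \<alpha>)"
    and "\<forall>Z\<in>small_subsets \<mu> lam. \<exists>F\<in>\<F>. F \<subseteq> topspace X \<inter> (\<Inter>\<alpha>\<in>Z. C \<alpha>)"
  then obtain Fs where Fs: "\<And>Z. Z \<in> small_subsets \<mu> lam \<Longrightarrow> Fs Z \<in> \<F>"
      "\<And>Z. Z \<in> small_subsets \<mu> lam \<Longrightarrow> Fs Z \<subseteq> topspace X \<inter> (\<Inter>\<alpha>\<in>Z. C \<alpha>)"
    by metis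
  have "X closure_of (\<Union>{Fs Z |Z. Z \<in> small_subsets \<mu> lam \<and> \<alpha> \<in> Z}) \<subseteq> C \<alpha>"
    if "\<alpha> \<in> Field lam" for \<alpha>
    using C Fs(2) that by (intro closure_of_minimal) blast+
  moreover have "topspace X \<inter> (\<Inter>\<alpha>\<in>Field lam.
          X closure_of (\<Union>{Fs Z |Z. Z \<in> small_subsets \<mu> lam \<and> \<alpha> \<in> Z})) \<noteq> {}"
    using sc Fs(1) unfolding selection_compact_def by blast
  ultimately show "topspace X \<inter> (\<Inter>\<alpha>\<in>Field lam. C \<alpha>) \<noteq> {}" by blast
qed

text \<open>The finite subsets of \<open>lam\<close> are listed by \<open>lam\<close> itself, as \<open>g \<beta>\<close>. For small \<open>Z\<close> the set
  \<open>\<Union>\<beta>\<in>Z. g \<beta>\<close> is again small, and its value under \<open>Fs\<close> lies below every \<open>Q (g \<beta>)\<close> with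
  \<open>\<beta> \<in> Z\<close>.\<close>

lemma family_imp_finite_selection_compact:
  assumes fc: "family_compact X \<F> \<mu> lam" and sub: "\<F> \<subseteq> Pow (topspace X)"
    and \<mu>: "Cinfinite \<mu>" and lam: "Cinfinite lam"
  shows "finite_selection_compact X \<F> \<mu> lam"
  unfolding finite_selection_compact_def
proof (intro allI impI)
  fix Fs
  assume Fs: "\<forall>Z\<in>small_subsets \<mu> lam. Fs Z \<in> \<F>"
  define Q where "Q W = \<Union>{Fs Z |Z. Z \<in> small_subsets \<mu> lam \<and> W \<subseteq> Z}" for W
  have QX: "Q W \<subseteq> topspace X" for W using Fs sub unfolding Q_def by blast
  obtain g where g: "g ` Field lam = {W. finite W \<and> W \<subseteq> Field lam}"
    using surj_finite_subsets lam unfolding cinfinite_def by blast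
  then have gfin: "finite (g \<beta>)" "g \<beta> \<subseteq> Field lam" if "\<beta> \<in> Field lam" for \<beta>
    using that by auto
  have "\<exists>F\<in>\<F>. F \<subseteq> topspace X \<inter> (\<Inter>\<beta>\<in>Z. Q (g \<beta>))" if Z: "Z \<in> small_subsets \<mu> lam" for Z
  proof -
    let ?Z = "\<Union>\<beta>\<in>Z. g \<beta>"
    have S: "?Z \<in> small_subsets \<mu> lam"
      using Z gfin by (intro small_subsets_UN \<mu>) (auto simp: small_subsets_def)
    then have "Fs ?Z \<in> \<F>" using Fs by blast
    moreover have "Fs ?Z \<subseteq> Q (g \<beta>)" if "\<beta> \<in> Z" for \<beta> using S that unfolding Q_def by blast
    ultimately show ?thesis using sub by (intro bexI[of _ "Fs ?Z"]) auto
  qed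
  then have "topspace X \<inter> (\<Inter>\<beta>\<in>Field lam. X closure_of Q (g \<beta>)) \<noteq> {}"
    using family_imp_closure_compact[OF fc, unfolded closure_compact_def, rule_format,
        of "\<lambda>\<beta>. Q (g \<beta>)"] QX by simp
  also have "(\<Inter>\<beta>\<in>Field lam. X closure_of Q (g \<beta>)) = (\<Inter>W\<in>g ` Field lam. X closure_of Q W)"
    by simp
  finally show "topspace X \<inter> (\<Inter>W\<in>{W. finite W \<and> W \<subseteq> Field lam}.
      X closure_of (\<Union>{Fs Z |Z. Z \<in> small_subsets \<mu> lam \<and> W \<subseteq> Z})) \<noteq> {}"
    unfolding g Q_def .
qed

text \<open>The sets \<open>b W V\<close> of the proof must belong to the ultrafilter, and they suffice: \<open>W = {\<alpha>}\<close> yields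
  that it covers \<open>lam\<close>, and \<open>W = {}\<close> that \<open>x\<close> is a limit point. That \<open>x\<close> lies in the closures for
  all finite \<open>W\<close>, not merely for singletons, is what makes them nonempty, hence a filter base.\<close>

lemma finite_selection_imp_ultrafilter_compact:
  assumes fs: "finite_selection_compact X \<F> \<mu> lam"
  shows "ultrafilter_compact X \<F> \<mu> lam"
  unfolding ultrafilter_compact_def
proof (intro allI impI)
  fix Fs
  let ?S = "small_subsets \<mu> lam"
  assume "\<forall>Z\<in>?S. Fs Z \<in> \<F>"
  then have "topspace X \<inter> (\<Inter>W\<in>{W. finite W \<and> W \<subseteq> Field lam}.
      X closure_of (\<Union>{Fs Z |Z. Z \<in> ?S \<and> W \<subseteq> Z})) \<noteq> {}"
    using fs unfolding finite_selection_compact_def by simp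
  then obtain x where x: "x \<in> topspace X"
    and cl: "\<And>W. finite W \<Longrightarrow> W \<subseteq> Field lam \<Longrightarrow>
      x \<in> X closure_of (\<Union>{Fs Z |Z. Z \<in> ?S \<and> W \<subseteq> Z})"
    by blast
  define b where "b W V = {Z \<in> ?S. W \<subseteq> Z \<and> Fs Z \<inter> V \<noteq> {}}" for W V
  define B where "B = {b W V |W V. finite W \<and> W \<subseteq> Field lam \<and> openin X V \<and> x \<in> V}"
  have memB: "b W V \<in> B" if "finite W" "W \<subseteq> Field lam" "openin X V" "x \<in> V" for W V
    using that unfolding B_def by blast
  have "b W V \<noteq> {}" if "finite W" "W \<subseteq> Field lam" "openin X V" "x \<in> V" for W V
    using cl[OF that(1,2)] that(3,4) unfolding in_closure_of b_def by blast
  then have "{} \<notin> B" unfolding B_def by blast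
  moreover have "B \<noteq> {}" using memB[of "{}" "topspace X"] x by auto
  moreover have "B \<subseteq> Pow ?S" unfolding B_def b_def by blast
  moreover have "\<exists>A''\<in>B. A'' \<subseteq> A \<inter> A'" if AB: "A \<in> B" "A' \<in> B" for A A'
  proof -
    obtain W V W' V' where A: "A = b W V" "A' = b W' V'"
      and W: "finite W" "W \<subseteq> Field lam" "openin X V" "x \<in> V"
      and W': "finite W'" "W' \<subseteq> Field lam" "openin X V'" "x \<in> V'"
      using AB unfolding B_def by blast
    have "b (W \<union> W') (V \<inter> V') \<subseteq> A \<inter> A'" unfolding A b_def by blast
    moreover have "b (W \<union> W') (V \<inter> V') \<in> B" using W W' by (intro memB) auto
    ultimately show ?thesis by blast
  qed
  ultimately obtain D where D: "ultrafilter_over ?S D" and BD: "B \<subseteq> D"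
    by (rule ultrafilter_extending_base)
  have up: "A' \<in> D" if "A \<in> B" "A \<subseteq> A'" "A' \<subseteq> ?S" for A A'
  proof -
    have "A \<in> D" using BD that(1) by blast
    then show ?thesis using D that(2,3) unfolding ultrafilter_over_def by metis
  qed
  have "covers D \<mu> lam"
    unfolding covers_def
  proof
    fix \<alpha> assume "\<alpha> \<in> Field lam"
    then have "b {\<alpha>} (topspace X) \<in> B" using x by (intro memB) auto
    then show "{Z \<in> ?S. \<alpha> \<in> Z} \<in> D" by (rule up) (auto simp: b_def)
  qed
  moreover have "limit_point X ?S D Fs x"
    unfolding limit_point_def
  proof (intro conjI allI impI x)
    fix U assume "neighborhood X x U"
    then obtain V where V: "openin X V" "x \<in> V" "V \<subseteq> U" unfolding neighborhood_def by blast
    then have "b {} V \<in> B" by (intro memB) auto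
    then show "{Z \<in> ?S. Fs Z \<inter> U \<noteq> {}} \<in> D" by (rule up) (use V in \<open>auto simp: b_def\<close>)
  qed
  ultimately show "\<exists>D. ultrafilter_over ?S D \<and> covers D \<mu> lam \<and> (\<exists>x. limit_point X ?S D Fs x)"
    using D by blast
qed

text \<open>For a neighborhood \<open>V\<close> of a limit point, the set of \<open>Z\<close> for which \<open>Fs Z\<close> meets \<open>V\<close> and the set
  of \<open>Z\<close> containing \<open>\<alpha>\<close> both belong to the ultrafilter, so they share some \<open>Z\<close>.\<close>

lemma ultrafilter_imp_selection_compact:
  assumes uc: "ultrafilter_compact X \<F> \<mu> lam"
  shows "selection_compact X \<F> \<mu> lam"
  unfolding selection_compact_def
proof (intro allI impI)
  fix Fs
  let ?S = "small_subsets \<mu> lam"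
  assume "\<forall>Z\<in>?S. Fs Z \<in> \<F>"
  then obtain D x where D: "ultrafilter_over ?S D" "covers D \<mu> lam" and x: "limit_point X ?S D Fs x"
    using uc unfolding ultrafilter_compact_def by metis
  have inter: "A \<inter> A' \<noteq> {}" if "A \<in> D" "A' \<in> D" for A A'
    using D(1) that unfolding ultrafilter_over_def by metis
  have x_cl: "x \<in> X closure_of (\<Union>{Fs Z |Z. Z \<in> ?S \<and> \<alpha> \<in> Z})" if \<alpha>: "\<alpha> \<in> Field lam" for \<alpha>
    unfolding in_closure_of
  proof (intro conjI allI impI)
    show "x \<in> topspace X" using x unfolding limit_point_def by blast
    fix V assume "x \<in> V \<and> openin X V"
    then have "neighborhood X x V" unfolding neighborhood_def using openin_subset by blast
    then have "{Z \<in> ?S. Fs Z \<inter> V \<noteq> {}} \<in> D" using x unfolding limit_point_def by blast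
    moreover have "{Z \<in> ?S. \<alpha> \<in> Z} \<in> D" using D(2) \<alpha> unfolding covers_def by blast
    ultimately have "{Z \<in> ?S. Fs Z \<inter> V \<noteq> {}} \<inter> {Z \<in> ?S. \<alpha> \<in> Z} \<noteq> {}"
      by (rule inter)
    then show "\<exists>y. y \<in> \<Union>{Fs Z |Z. Z \<in> ?S \<and> \<alpha> \<in> Z} \<and> y \<in> V" by blast
  qed
  show "topspace X \<inter> (\<Inter>\<alpha>\<in>Field lam. X closure_of (\<Union>{Fs Z |Z. Z \<in> ?S \<and> \<alpha> \<in> Z})) \<noteq> {}"
    using x x_cl unfolding limit_point_def by fast
qed

lemma family_compact_iff_cover_compact:
  assumes sub: "\<F> \<subseteq> Pow (topspace X)"
  shows "family_compact X \<F> \<mu> lam \<longleftrightarrow> cover_compact X \<F> \<mu> lam"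
proof
  assume fc: "family_compact X \<F> \<mu> lam"
  show "cover_compact X \<F> \<mu> lam"
    unfolding cover_compact_def
  proof (intro allI impI, rule ccontr)
    fix Q
    assume Q: "(\<forall>\<alpha>\<in>Field lam. openin X (Q \<alpha>)) \<and> (\<Union>\<alpha>\<in>Field lam. Q \<alpha>) = topspace X"
      and no: "\<not> (\<exists>Z\<in>small_subsets \<mu> lam. \<forall>F\<in>\<F>. F \<inter> (\<Union>\<alpha>\<in>Z. Q \<alpha>) \<noteq> {})"
    have small: "\<exists>F\<in>\<F>. F \<subseteq> topspace X \<inter> (\<Inter>\<alpha>\<in>Z. topspace X - Q \<alpha>)"
      if Z: "Z \<in> small_subsets \<mu> lam" for Z
    proof -
      obtain F where F: "F \<in> \<F>" "F \<inter> (\<Union>\<alpha>\<in>Z. Q \<alpha>) = {}" using no Z by blast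
      moreover have "F \<subseteq> topspace X" using sub F(1) by blast
      ultimately show ?thesis by (intro bexI[of _ F]) fast+
    qed
    have closed: "closedin X (topspace X - Q \<alpha>)" if "\<alpha> \<in> Field lam" for \<alpha>
      using Q that by blast
    have "topspace X \<inter> (\<Inter>\<alpha>\<in>Field lam. topspace X - Q \<alpha>) \<noteq> {}"
      using fc[unfolded family_compact_def, rule_format, OF closed small] .
    then obtain x where "x \<in> topspace X" and x: "\<And>\<alpha>. \<alpha> \<in> Field lam \<Longrightarrow> x \<notin> Q \<alpha>" by blast
    then have "x \<in> (\<Union>\<alpha>\<in>Field lam. Q \<alpha>)" using Q by simp
    then show False using x by blast
  qed
next
  assume cc: "cover_compact X \<F> \<mu> lam"
  show "family_compact X \<F> \<mu> lam"
    unfolding family_compact_def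
  proof (intro allI impI, rule ccontr)
    fix C
    assume C: "\<forall>\<alpha>\<in>Field lam. closedin X (C \<alpha>)"
      and small: "\<forall>Z\<in>small_subsets \<mu> lam. \<exists>F\<in>\<F>. F \<subseteq> topspace X \<inter> (\<Inter>\<alpha>\<in>Z. C \<alpha>)"
      and empty: "\<not> topspace X \<inter> (\<Inter>\<alpha>\<in>Field lam. C \<alpha>) \<noteq> {}"
    have "(\<Union>\<alpha>\<in>Field lam. topspace X - C \<alpha>) = topspace X" using empty by blast
    moreover have "\<forall>\<alpha>\<in>Field lam. openin X (topspace X - C \<alpha>)" using C by blast
    ultimately obtain Z where Z: "Z \<in> small_subsets \<mu> lam"
      and meets: "\<forall>F\<in>\<F>. F \<inter> (\<Union>\<alpha>\<in>Z. topspace X - C \<alpha>) \<noteq> {}"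
      using cc[unfolded cover_compact_def, rule_format, of "\<lambda>\<alpha>. topspace X - C \<alpha>"] by meson
    obtain F where "F \<in> \<F>" and F: "F \<subseteq> topspace X \<inter> (\<Inter>\<alpha>\<in>Z. C \<alpha>)"
      using small[rule_format, OF Z] by (rule bexE)
    then have "F \<inter> (\<Union>\<alpha>\<in>Z. topspace X - C \<alpha>) \<noteq> {}" using meets by simp
    then obtain y \<alpha> where "y \<in> F" "\<alpha> \<in> Z" "y \<notin> C \<alpha>" by blast
    then show False using F by fast
  qed
qed

lemma family_compact_iff_selections:
  assumes "\<F> \<subseteq> Pow (topspace X)" and "Cinfinite \<mu>" and "Cinfinite lam"
  shows "family_compact X \<F> \<mu> lam \<longleftrightarrow> selection_compact X \<F> \<mu> lam"
    and "family_compact X \<F> \<mu> lam \<longleftrightarrow> finite_selection_compact X \<F> \<mu> lam"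
    and "family_compact X \<F> \<mu> lam \<longleftrightarrow> ultrafilter_compact X \<F> \<mu> lam"
  using assms family_imp_finite_selection_compact finite_selection_imp_ultrafilter_compact
    ultrafilter_imp_selection_compact selection_imp_family_compact
  by metis+

lemma family_compact_iff_closure_compact:
  assumes sub: "\<F> \<subseteq> Pow (topspace X)"
    and H: "H \<in> cofinal_families \<mu> lam" "|H| \<le>o \<kappa>"
    and \<Q>: "unions_le \<kappa> \<F> \<subseteq> \<Q>" "\<Q> \<subseteq> Pow (topspace X)"
  shows "family_compact X \<F> \<mu> lam \<longleftrightarrow> closure_compact \<Q> X \<F> \<mu> lam"
proof
  show "closure_compact \<Q> X \<F> \<mu> lam" if "family_compact X \<F> \<mu> lam"
    using closure_compact_antimono[OF family_imp_closure_compact[OF that] \<Q>(2)] .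
  show "family_compact X \<F> \<mu> lam" if "closure_compact \<Q> X \<F> \<mu> lam"
    using selection_imp_family_compact[OF closure_compact_unions_le_imp_selection[OF
          closure_compact_antimono[OF that \<Q>(1)] sub H]] .
qed

theorem theorem5p2:
  fixes X :: "'a topology" and \<F> :: "'a set set"
    and \<mu> :: "'m rel" and lam :: "'l rel"
  assumes "\<F> \<subseteq> Pow (topspace X)"
    and "Cinfinite \<mu>" and "Cinfinite lam"
  shows
    "(family_compact X \<F> \<mu> lam \<longleftrightarrow>
        (\<forall>P. (\<forall>\<alpha>\<in>Field lam. P \<alpha> \<in> Pow (topspace X)) \<longrightarrow>
           (\<forall>Z \<in> small_subsets \<mu> lam. \<exists>F\<in>\<F>. F \<subseteq> topspace X \<inter> (\<Inter>\<alpha>\<in>Z. P \<alpha>)) \<longrightarrow>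
           topspace X \<inter> (\<Inter>\<alpha>\<in>Field lam. X closure_of P \<alpha>) \<noteq> {})) \<and>
     (family_compact X \<F> \<mu> lam \<longleftrightarrow>
        (\<forall>Q. (\<forall>\<alpha>\<in>Field lam. Q \<alpha> \<in> unions \<F>) \<longrightarrow>
           (\<forall>Z \<in> small_subsets \<mu> lam. \<exists>F\<in>\<F>. F \<subseteq> topspace X \<inter> (\<Inter>\<alpha>\<in>Z. Q \<alpha>)) \<longrightarrow>
           topspace X \<inter> (\<Inter>\<alpha>\<in>Field lam. X closure_of Q \<alpha>) \<noteq> {})) \<and>
     (family_compact X \<F> \<mu> lam \<longleftrightarrow>
        (\<forall>Q. (\<forall>\<alpha>\<in>Field lam. Q \<alpha> \<in> unions_le (weak_power lam \<mu>) \<F>) \<longrightarrow>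
           (\<forall>Z \<in> small_subsets \<mu> lam. \<exists>F\<in>\<F>. F \<subseteq> topspace X \<inter> (\<Inter>\<alpha>\<in>Z. Q \<alpha>)) \<longrightarrow>
           topspace X \<inter> (\<Inter>\<alpha>\<in>Field lam. X closure_of Q \<alpha>) \<noteq> {})) \<and>
     (family_compact X \<F> \<mu> lam \<longleftrightarrow>
        (\<forall>Q. (\<forall>\<alpha>\<in>Field lam. Q \<alpha> \<in> unions_le (cf_small_subsets \<mu> lam) \<F>) \<longrightarrow>
           (\<forall>Z \<in> small_subsets \<mu> lam. \<exists>F\<in>\<F>. F \<subseteq> topspace X \<inter> (\<Inter>\<alpha>\<in>Z. Q \<alpha>)) \<longrightarrow>
           topspace X \<inter> (\<Inter>\<alpha>\<in>Field lam. X closure_of Q \<alpha>) \<noteq> {})) \<and>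
     (family_compact X \<F> \<mu> lam \<longleftrightarrow>
        (\<forall>Fs. (\<forall>Z \<in> small_subsets \<mu> lam. Fs Z \<in> \<F>) \<longrightarrow>
           topspace X \<inter> (\<Inter>\<alpha>\<in>Field lam.
             X closure_of (\<Union>{Fs Z |Z. Z \<in> small_subsets \<mu> lam \<and> \<alpha> \<in> Z})) \<noteq> {})) \<and>
     (family_compact X \<F> \<mu> lam \<longleftrightarrow>
        (\<forall>Fs. (\<forall>Z \<in> small_subsets \<mu> lam. Fs Z \<in> \<F>) \<longrightarrow>
           topspace X \<inter> (\<Inter>W\<in>{W. finite W \<and> W \<subseteq> Field lam}.
             X closure_of (\<Union>{Fs Z |Z. Z \<in> small_subsets \<mu> lam \<and> W \<subseteq> Z})) \<noteq> {})) \<and>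
     (family_compact X \<F> \<mu> lam \<longleftrightarrow>
        (\<forall>Q. (\<forall>\<alpha>\<in>Field lam. openin X (Q \<alpha>)) \<and> (\<Union>\<alpha>\<in>Field lam. Q \<alpha>) = topspace X \<longrightarrow>
           (\<exists>Z \<in> small_subsets \<mu> lam. \<forall>F\<in>\<F>. F \<inter> (\<Union>\<alpha>\<in>Z. Q \<alpha>) \<noteq> {}))) \<and>
     (family_compact X \<F> \<mu> lam \<longleftrightarrow>
        (\<forall>Fs. (\<forall>Z \<in> small_subsets \<mu> lam. Fs Z \<in> \<F>) \<longrightarrow>
           (\<exists>D. ultrafilter_over (small_subsets \<mu> lam) D \<and> covers D \<mu> lam \<and>
                (\<exists>x. limit_point X (small_subsets \<mu> lam) D Fs x))))"
proof -
  let ?\<kappa> = "cf_small_subsets \<mu> lam" and ?\<pi> = "weak_power lam \<mu>"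
  note sub = assms(1)
  obtain H where H: "H \<in> cofinal_families \<mu> lam" "|H| \<le>o ?\<kappa>"
    using cofinal_family_attaining_cf ordIso_imp_ordLeq by metis
  have le: "unions_le r \<F> \<subseteq> unions \<F>" for r :: "'k rel"
    unfolding unions_le_def unions_def by blast
  have un: "unions \<F> \<subseteq> Pow (topspace X)"
    using sub unfolding unions_def by blast
  note iff_cf = family_compact_iff_closure_compact[OF sub H]
  have "family_compact X \<F> \<mu> lam \<longleftrightarrow> closure_compact (Pow (topspace X)) X \<F> \<mu> lam"
    using le un by (intro iff_cf) blast+
  moreover have "family_compact X \<F> \<mu> lam \<longleftrightarrow> closure_compact (unions \<F>) X \<F> \<mu> lam"
    using le un by (intro iff_cf) blast+
  moreover have "family_compact X \<F> \<mu> lam \<longleftrightarrow> closure_compact (unions_le ?\<pi> \<F>) X \<F> \<mu> lam"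
    using le[of ?\<pi>] un
    by (intro family_compact_iff_closure_compact[OF sub cofinal_families_nonempty
          card_small_subsets_le_weak_power[OF assms(2,3)]]) blast+
  moreover have "family_compact X \<F> \<mu> lam \<longleftrightarrow> closure_compact (unions_le ?\<kappa> \<F>) X \<F> \<mu> lam"
    using le[of ?\<kappa>] un by (intro iff_cf) blast+
  ultimately show ?thesis
    using family_compact_iff_selections[OF assms] family_compact_iff_cover_compact[OF sub, of \<mu> lam]
    unfolding closure_compact_def selection_compact_def finite_selection_compact_def
      cover_compact_def ultrafilter_compact_def
    by (intro conjI)
qed

end
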